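(* Let $n$ be a positive integer and let $\mathbf{a}=(a_1,\dots,a_n)\in(\mathbb{C}^* )^n$ (all $a_i\neq 0$). Any nontrivial $W_n$-module $M\in\Omega_{\mathbf{a}}^W$ is, when restricted to $U(\mathfrak{h}_n)$, a free $U(\mathfrak{h}_n)$-module of finite rank.
   Context: Notation: $A_n=\mathbb{C}[t_1,\dots,t_n]$, $\partial_i=\partial/\partial t_i$, $W_n=\mathrm{Der}(A_n)=\bigoplus_{i=1}^n A_n\partial_i$ is the Lie algebra of derivations of $A_n$, $\Delta_n=\mathrm{Span}\{\partial_1,\dots,\partial_n\}$, $h_i=t_i\partial_i$, and $\mathfrak{h}_n=\mathbb{C}h_1\oplus\cdots\oplus\mathbb{C}h_n$ is the Cartan subalgebra of $W_n$. $\phi_{\mathbf{a}}:\Delta_n\to\mathbb{C}$ is the linear map with $\phi_{\mathbf{a}}(\partial_i)=a_i$. A $W_n$-module $M$ is a Whittaker module of type $\phi_{\mathbf{a}}$ if for any $v\in M$ there is $k\in\mathbb{N}$ with $(x-\phi_{\mathbf{a}}(x))^kv=0$ for all $x\in\Delta_n$. Put $\mathrm{Wh}_{\mathbf{a}}(M)=\{v\in M\mid \partial_i v=a_i v,\ i=1,\dots,n\}$. $\Omega_{\mathbf{a}}^W$ is the category of Whittaker $W_n$-modules $M$ of type $\phi_{\mathbf{a}}$ with $\dim\mathrm{Wh}_{\mathbf{a}}(M)<\infty$. A module is trivial if every element of $W_n$ acts as zero on it. *)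

theory Defs
  imports Complex_Main "HOL-Library.Poly_Mapping"
begin

section \<open>Finitely supported functions\<close>

lemma poly_mapping_additive_induct [case_names zero single add]:
  fixes p :: "'k \<Rightarrow>\<^sub>0 'c::comm_monoid_add"
  assumes "P 0" and "\<And>k c. P (Poly_Mapping.single k c)"
    and "\<And>p q. P p \<Longrightarrow> P q \<Longrightarrow> P (p + q)"
  shows "P p"
proof -
  have fin: "P (\<Sum>k\<in>K. Poly_Mapping.single k (Poly_Mapping.lookup p k))" if "finite K" for K
    using that by induction (auto intro: assms)
  have "(\<Sum>k\<in>Poly_Mapping.keys p. Poly_Mapping.single k (Poly_Mapping.lookup p k)) = p"
    by (rule poly_mapping_eqI)
       (simp add: lookup_sum lookup_single when_def in_keys_iff)
  with fin[of "Poly_Mapping.keys p"] show ?thesis by simp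
qed


section \<open>Complex Lie algebras\<close>

class lie_algebra = ab_group_add +
  fixes lie_scale :: "complex \<Rightarrow> 'a \<Rightarrow> 'a"
    and lie_bracket :: "'a \<Rightarrow> 'a \<Rightarrow> 'a"
  assumes lie_scale_add: "lie_scale c (x + y) = lie_scale c x + lie_scale c y"
    and lie_scale_add_left: "lie_scale (c + d) x = lie_scale c x + lie_scale d x"
    and lie_scale_scale: "lie_scale c (lie_scale d x) = lie_scale (c * d) x"
    and lie_scale_one: "lie_scale 1 x = x"
    and lie_bracket_add_left: "lie_bracket (x + y) z = lie_bracket x z + lie_bracket y z"
    and lie_bracket_add_right: "lie_bracket x (y + z) = lie_bracket x y + lie_bracket x z"
    and lie_bracket_scale_left: "lie_bracket (lie_scale c x) y = lie_scale c (lie_bracket x y)"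
    and lie_bracket_scale_right: "lie_bracket x (lie_scale c y) = lie_scale c (lie_bracket x y)"
    and lie_bracket_self: "lie_bracket x x = 0"
    and lie_jacobi: "lie_bracket x (lie_bracket y z) + lie_bracket y (lie_bracket z x)
                       + lie_bracket z (lie_bracket x y) = 0"

class abelian_lie_algebra = lie_algebra +
  assumes lie_bracket_abelian: "lie_bracket x y = 0"

interpretation lie: vector_space "lie_scale :: complex \<Rightarrow> 'g::lie_algebra \<Rightarrow> 'g"
  by unfold_locales (fact lie_scale_add lie_scale_add_left lie_scale_scale lie_scale_one)+

locale lie_module = vector_space scale
  for scale :: "complex \<Rightarrow> 'm::ab_group_add \<Rightarrow> 'm" +
  fixes act :: "'g::lie_algebra \<Rightarrow> 'm \<Rightarrow> 'm"
  assumes act_add_left: "act (x + y) v = act x v + act y v"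
    and act_scale_left: "act (lie_scale c x) v = scale c (act x v)"
    and act_add_right: "act x (v + w) = act x v + act x w"
    and act_scale_right: "act x (scale c v) = scale c (act x v)"
    and act_bracket: "act (lie_bracket x y) v = act x (act y v) - act y (act x v)"


section \<open>The universal enveloping algebra\<close>

text \<open>
  The free unital associative algebra on the underlying set of a Lie algebra is the monoid
  algebra of the words over that set.  The universal enveloping algebra is its quotient by the
  two-sided ideal which makes the inclusion of letters linear and compatible with brackets; the
  linearity relations turn the free algebra into the tensor algebra.
\<close>

datatype 'g word = Word (letters: "'g list")

instantiation word :: (type) monoid_add
begin

definition zero_word :: "'a word" where "0 = Word []"

definition plus_word :: "'a word \<Rightarrow> 'a word \<Rightarrow> 'a word"
  where "u + w = Word (letters u @ letters w)"

instance
  by standard (simp_all add: zero_word_def plus_word_def)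

end

type_synonym 'g free_algebra = "'g word \<Rightarrow>\<^sub>0 complex"

definition letter :: "'g \<Rightarrow> 'g free_algebra"
  where "letter x = Poly_Mapping.single (Word [x]) 1"

definition scalar :: "complex \<Rightarrow> 'g free_algebra"
  where "scalar c = Poly_Mapping.single 0 c"

inductive_set env_ideal :: "'g::lie_algebra free_algebra set" where
  env_zero: "0 \<in> env_ideal"
| env_add: "f \<in> env_ideal \<Longrightarrow> g \<in> env_ideal \<Longrightarrow> f + g \<in> env_ideal"
| env_mult_left: "f \<in> env_ideal \<Longrightarrow> g * f \<in> env_ideal"
| env_mult_right: "f \<in> env_ideal \<Longrightarrow> f * g \<in> env_ideal"
| env_letter_add: "letter (x + y) - letter x - letter y \<in> env_ideal"
| env_letter_scale: "letter (lie_scale c x) - scalar c * letter x \<in> env_ideal"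
| env_letter_bracket:
    "letter x * letter y - letter y * letter x - letter (lie_bracket x y) \<in> env_ideal"

lemma env_uminus: "f \<in> env_ideal \<Longrightarrow> - f \<in> env_ideal"
  using env_mult_left[of f "-1"] by simp

lemma env_diff: "f \<in> env_ideal \<Longrightarrow> g \<in> env_ideal \<Longrightarrow> f - g \<in> env_ideal"
  using env_add[OF _ env_uminus, of f g] by simp

definition env_eq :: "'g::lie_algebra free_algebra \<Rightarrow> 'g free_algebra \<Rightarrow> bool"
  where "env_eq f g \<longleftrightarrow> f - g \<in> env_ideal"

lemma env_eq_refl [simp]: "env_eq f f"
  by (simp add: env_eq_def env_zero)

lemma env_eq_equivp: "equivp env_eq"
proof (rule equivpI)
  show "reflp env_eq" by (simp add: reflp_def)
  show "symp env_eq"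
    unfolding symp_def env_eq_def using env_uminus by fastforce
  show "transp env_eq"
    unfolding transp_def env_eq_def using env_add by fastforce
qed

quotient_type (overloaded) 'g uea = "'g::lie_algebra free_algebra" / env_eq
  by (rule env_eq_equivp)

instantiation uea :: (lie_algebra) ring_1
begin

lift_definition zero_uea :: "'a uea" is 0 .

lift_definition one_uea :: "'a uea" is 1 .

lift_definition plus_uea :: "'a uea \<Rightarrow> 'a uea \<Rightarrow> 'a uea" is "(+)"
  unfolding env_eq_def by (metis add_diff_add env_add)

lift_definition uminus_uea :: "'a uea \<Rightarrow> 'a uea" is uminus
  unfolding env_eq_def by (metis env_uminus minus_diff_minus)

lift_definition minus_uea :: "'a uea \<Rightarrow> 'a uea \<Rightarrow> 'a uea" is "(-)"
proof -
  fix f f' g g' :: "'a free_algebra"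
  assume "env_eq f f'" "env_eq g g'"
  then have "(f - f') - (g - g') \<in> env_ideal"
    unfolding env_eq_def by (rule env_diff)
  then show "env_eq (f - g) (f' - g')"
    by (simp add: env_eq_def algebra_simps)
qed

lift_definition times_uea :: "'a uea \<Rightarrow> 'a uea \<Rightarrow> 'a uea" is "(*)"
proof -
  fix f f' g g' :: "'a free_algebra"
  assume "env_eq f f'" "env_eq g g'"
  then have "(f - f') * g + f' * (g - g') \<in> env_ideal"
    unfolding env_eq_def by (intro env_add env_mult_left env_mult_right)
  then show "env_eq (f * g) (f' * g')"
    by (simp add: env_eq_def algebra_simps)
qed

lemma one_not_in_env_ideal: "(1 :: 'a free_algebra) \<notin> env_ideal"
proof
  \<comment> \<open>the augmentation, i.e. the coefficient of the empty word, kills the ideal\<close>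
  have append_Nil: "0 = l + q \<longleftrightarrow> l = 0 \<and> q = 0" for l q :: "'a word"
    by (cases l; cases q) (auto simp: zero_word_def plus_word_def)
  have mult: "Poly_Mapping.lookup (f * g) 0 = Poly_Mapping.lookup f 0 * Poly_Mapping.lookup g 0"
    for f g :: "'a free_algebra"
  proof -
    have "Poly_Mapping.lookup (f * g) 0 = (\<Sum>l. Poly_Mapping.lookup f l *
        (\<Sum>q. Poly_Mapping.lookup g q when l = 0 when q = 0))"
      by (simp add: lookup_mult append_Nil when_when conj_commute)
    also have "\<dots> = (\<Sum>l. Poly_Mapping.lookup f l * Poly_Mapping.lookup g 0 when l = 0)"
      by (rule Sum_any.cong) (simp add: when_def)
    finally show ?thesis by simp
  qed
  have letter: "Poly_Mapping.lookup (letter x) 0 = 0" for x :: 'a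
    by (simp add: letter_def lookup_single zero_word_def)
  have "Poly_Mapping.lookup f 0 = 0" if "f \<in> env_ideal" for f :: "'a free_algebra"
    using that by induction (simp_all add: lookup_add lookup_minus mult letter)
  moreover assume "(1 :: 'a free_algebra) \<in> env_ideal"
  ultimately have "Poly_Mapping.lookup (1 :: 'a free_algebra) 0 = 0"
    by blast
  then show False
    by simp
qed

instance
proof
  show "(0 :: 'a uea) \<noteq> 1"
    using one_not_in_env_ideal env_uminus[of "- (1 :: 'a free_algebra)"]
    by transfer (auto simp: env_eq_def)
qed (transfer; simp add: algebra_simps)+

end

instance uea :: (abelian_lie_algebra) comm_ring_1
proof
  have letters: "env_eq (letter x * letter y) (letter y * letter x)" for x y :: 'a
  proof -
    have "letter (lie_scale 0 (0::'a)) - scalar 0 * letter (0::'a) \<in> env_ideal"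
      by (rule env_letter_scale)
    then have "letter (0::'a) \<in> env_ideal"
      by (simp add: scalar_def)
    from env_add[OF env_letter_bracket[of x y] this] show ?thesis
      by (simp add: env_eq_def lie_bracket_abelian)
  qed
  have comm_mult: "env_eq (f * (g * h)) ((g * h) * f)"
    if "env_eq (f * g) (g * f)" "env_eq (f * h) (h * f)" for f g h :: "'a free_algebra"
  proof -
    have "(f * g - g * f) * h + g * (f * h - h * f) \<in> env_ideal"
      using that unfolding env_eq_def by (intro env_add env_mult_left env_mult_right)
    then show ?thesis by (simp add: env_eq_def algebra_simps)
  qed
  have comm_add: "env_eq (f * (g + h)) ((g + h) * f)"
    if "env_eq (f * g) (g * f)" "env_eq (f * h) (h * f)" for f g h :: "'a free_algebra"
  proof -
    have "(f * g - g * f) + (f * h - h * f) \<in> env_ideal"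
      using that unfolding env_eq_def by (intro env_add)
    then show ?thesis by (simp add: env_eq_def algebra_simps)
  qed
  have comm_sym: "env_eq (g * f) (f * g)" if "env_eq (f * g) (g * f)" for f g :: "'a free_algebra"
    using that equivp_symp[OF env_eq_equivp] by blast
  have comm_scalar: "env_eq (f * scalar c) (scalar c * f)" for f :: "'a free_algebra" and c
  proof -
    have "f * scalar c = scalar c * f"
      by (induction f rule: poly_mapping_additive_induct)
         (simp_all add: scalar_def mult_single algebra_simps)
    then show ?thesis by simp
  qed
  have extend: "env_eq (f * g) (g * f)"
    if letter: "\<And>x. env_eq (f * letter x) (letter x * f)" for f g :: "'a free_algebra"
  proof (induction g rule: poly_mapping_additive_induct)
    case (single k c)
    have "env_eq (f * Poly_Mapping.single (Word xs) c) (Poly_Mapping.single (Word xs) c * f)" for xs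
    proof (induction xs)
      case Nil
      show ?case using comm_scalar[of f c] by (simp add: scalar_def zero_word_def)
    next
      case (Cons x xs)
      have "Poly_Mapping.single (Word (x # xs)) c = letter x * Poly_Mapping.single (Word xs) c"
        by (simp add: letter_def mult_single plus_word_def)
      then show ?case using comm_mult[OF letter[of x] Cons.IH] by simp
    qed
    then show ?case by (cases k) simp
  qed (use comm_add in auto)
  have "env_eq (letter x * f) (f * letter x)" for f :: "'a free_algebra" and x
    by (rule extend) (rule letters)
  then have "env_eq (f * g) (g * f)" for f g :: "'a free_algebra"
    by (meson extend comm_sym)
  then show "a * b = b * a" for a b :: "'a uea"
    by transfer
  show "(a + b) * c = a * c + b * c" for a b c :: "'a uea"
    by (rule distrib_right)
qed simp_all

text \<open>
  A word acts on a Lie algebra module by applying its letters from right to left.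
\<close>

definition free_act ::
    "(complex \<Rightarrow> 'm::ab_group_add \<Rightarrow> 'm) \<Rightarrow> ('g \<Rightarrow> 'm \<Rightarrow> 'm) \<Rightarrow> 'g free_algebra \<Rightarrow> 'm \<Rightarrow> 'm"
  where "free_act scale act f v =
    (\<Sum>w\<in>Poly_Mapping.keys f. scale (Poly_Mapping.lookup f w) (foldr act (letters w) v))"

text \<open>
  The next definition goes through a chosen representative of the class; \<open>uea_act_abs\<close> below
  shows that on a Lie algebra module the choice does not matter.
\<close>

definition uea_act ::
    "(complex \<Rightarrow> 'm::ab_group_add \<Rightarrow> 'm) \<Rightarrow> ('g::lie_algebra \<Rightarrow> 'm \<Rightarrow> 'm) \<Rightarrow> 'g uea \<Rightarrow> 'm \<Rightarrow> 'm"
  where "uea_act scale act u = free_act scale act (rep_uea u)"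

context lie_module
begin

lemma foldr_act_add: "foldr act xs (v + w) = foldr act xs v + foldr act xs w"
  by (induction xs) (simp_all add: act_add_right)

lemma foldr_act_scale: "foldr act xs (scale c v) = scale c (foldr act xs v)"
  by (induction xs) (simp_all add: act_scale_right)

lemma free_act_zero [simp]: "free_act scale act 0 v = 0"
  by (simp add: free_act_def)

lemma free_act_single:
  "free_act scale act (Poly_Mapping.single w c) v = scale c (foldr act (letters w) v)"
  by (simp add: free_act_def)

lemma free_act_add: "free_act scale act (f + g) v = free_act scale act f v + free_act scale act g v"
  unfolding free_act_def
  by (rule setsum_keys_plus_distrib) (simp_all add: scale_left_distrib)

lemma free_act_uminus: "free_act scale act (- f) v = - free_act scale act f v"
  using free_act_add[of f "- f" v] by (simp add: add_eq_0_iff)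

lemma free_act_diff: "free_act scale act (f - g) v = free_act scale act f v - free_act scale act g v"
  using free_act_add[of f "- g" v] by (simp add: free_act_uminus)

lemma free_act_add_right:
  "free_act scale act f (v + w) = free_act scale act f v + free_act scale act f w"
  by (simp add: free_act_def foldr_act_add scale_right_distrib sum.distrib)

lemma free_act_scale_right: "free_act scale act f (scale c v) = scale c (free_act scale act f v)"
  by (simp add: free_act_def foldr_act_scale scale_sum_right mult.commute)

lemma free_act_zero_right: "free_act scale act f 0 = 0"
  using free_act_scale_right[of f 0 0] by simp

lemma free_act_mult: "free_act scale act (f * g) v = free_act scale act f (free_act scale act g v)"
proof (induction f rule: poly_mapping_additive_induct)
  case (single k c)
  show ?case
  proof (induction g rule: poly_mapping_additive_induct)
    case zero
    show ?case by (simp add: free_act_zero_right)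
  next
    case (single l d)
    show ?case
      by (simp add: mult_single free_act_single plus_word_def foldr_act_scale)
  next
    case (add p q)
    then show ?case by (simp add: distrib_left free_act_add free_act_add_right)
  qed
qed (simp_all add: distrib_right free_act_add)

lemma free_act_letter [simp]: "free_act scale act (letter x) v = act x v"
  by (simp add: letter_def free_act_single)

lemma free_act_scalar [simp]: "free_act scale act (scalar c) v = scale c v"
  by (simp add: scalar_def free_act_single zero_word_def)

lemma free_act_env_ideal: "f \<in> env_ideal \<Longrightarrow> free_act scale act f v = 0"
  by (induction arbitrary: v rule: env_ideal.induct)
     (simp_all add: free_act_add free_act_diff free_act_mult free_act_zero_right
        act_add_left act_scale_left act_bracket)

lemma uea_act_abs: "uea_act scale act (abs_uea f) v = free_act scale act f v"
proof -
  have "env_eq (rep_uea (abs_uea f)) f"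
    by (rule Quotient3_rep_abs[OF Quotient3_uea]) simp
  then have "free_act scale act (rep_uea (abs_uea f) - f) v = 0"
    unfolding env_eq_def by (rule free_act_env_ideal)
  then show ?thesis
    by (simp add: uea_act_def free_act_diff)
qed

end

lemma uea_module:
  fixes act :: "'g::abelian_lie_algebra \<Rightarrow> 'm::ab_group_add \<Rightarrow> 'm"
  assumes "lie_module scale act"
  shows "module (uea_act scale act)"
proof -
  interpret lie_module scale act by (rule assms)
  have reps: "\<exists>f. u = abs_uea f" for u :: "'g uea"
    by (metis Quotient3_abs_rep[OF Quotient3_uea])
  show ?thesis
  proof
    fix u w :: "'g uea" and v v'
    obtain f g where u: "u = abs_uea f" and w: "w = abs_uea g"
      using reps by metis
    show "uea_act scale act u (v + v') = uea_act scale act u v + uea_act scale act u v'"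
      by (simp add: u uea_act_abs free_act_add_right)
    show "uea_act scale act (u + w) v = uea_act scale act u v + uea_act scale act w v"
      by (simp add: u w plus_uea.abs_eq uea_act_abs free_act_add)
    show "uea_act scale act u (uea_act scale act w v) = uea_act scale act (u * w) v"
      by (simp add: u w times_uea.abs_eq uea_act_abs free_act_mult)
    have "free_act scale act 1 v = v"
      using free_act_scalar[of 1 v] by (simp add: scalar_def)
    then show "uea_act scale act 1 v = v"
      by (simp add: one_uea_def uea_act_abs)
  qed
qed

definition free_of_finite_rank :: "('r::comm_ring_1 \<Rightarrow> 'm::ab_group_add \<Rightarrow> 'm) \<Rightarrow> bool"
  where "free_of_finite_rank s \<longleftrightarrow> module s \<and>
    (\<exists>B. finite B \<and> \<not> module.dependent s B \<and> module.span s B = UNIV)"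


section \<open>The Lie algebra of derivations of a polynomial algebra\<close>

text \<open>
  Polynomials in \<open>CARD('n)\<close> variables, indexed by the elements of \<open>'n\<close>: a polynomial maps an
  exponent vector to its coefficient.
\<close>

type_synonym 'n pol = "('n \<Rightarrow>\<^sub>0 nat) \<Rightarrow>\<^sub>0 complex"

definition cst :: "complex \<Rightarrow> 'n pol"
  where "cst c = Poly_Mapping.single 0 c"

definition var :: "'n \<Rightarrow> 'n pol"
  where "var i = Poly_Mapping.single (Poly_Mapping.single i 1) 1"

definition is_derivation :: "('n pol \<Rightarrow> 'n pol) \<Rightarrow> bool"
  where "is_derivation D \<longleftrightarrow>
    (\<forall>p q. D (p + q) = D p + D q) \<and>
    (\<forall>c p. D (cst c * p) = cst c * D p) \<and>
    (\<forall>p q. D (p * q) = D p * q + p * D q)"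

lemma is_derivation_iff:
  "is_derivation D \<longleftrightarrow>
    (\<forall>p q. D (p + q) = D p + D q) \<and> D 0 = 0 \<and> (\<forall>c. D (cst c) = 0) \<and>
    (\<forall>p q. D (p * q) = D p * q + p * D q)"
proof
  assume D: "is_derivation D"
  then have "D (0 + 0) = D 0 + D 0" "D (1 * 1) = D 1 * 1 + 1 * D 1"
    unfolding is_derivation_def by blast+
  moreover have "D (cst c * 1) = cst c * D 1" for c
    using D unfolding is_derivation_def by blast
  ultimately show "(\<forall>p q. D (p + q) = D p + D q) \<and> D 0 = 0 \<and> (\<forall>c. D (cst c) = 0) \<and>
      (\<forall>p q. D (p * q) = D p * q + p * D q)"
    using D by (simp add: is_derivation_def)
qed (simp add: is_derivation_def)

typedef (overloaded) 'n witt = "{D :: 'n::finite pol \<Rightarrow> 'n pol. is_derivation D}"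
  morphisms der Abs_witt
  by (rule exI[of _ "\<lambda>_. 0"]) (simp add: is_derivation_def)

setup_lifting type_definition_witt

lemma witt_eqI: "(\<And>p. der D p = der E p) \<Longrightarrow> D = E"
  using der_inject by blast

lemma
  shows der_add: "der D (p + q) = der D p + der D q"
    and der_cst: "der D (cst c * p) = cst c * der D p"
    and der_mult: "der D (p * q) = der D p * q + p * der D q"
  using der[of D] unfolding is_derivation_def by blast+

lemma der_const [simp]: "der D (cst c) = 0"
  using der[of D] by (simp add: is_derivation_iff)

lemma der_zero [simp]: "der D 0 = 0"
  using der_add[of D 0 0] by simp

lemma der_uminus: "der D (- p) = - der D p"
  using der_add[of D p "- p"] by (simp add: add_eq_0_iff)

lemma der_diff: "der D (p - q) = der D p - der D q"
  using der_add[of D p "- q"] by (simp add: der_uminus)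

lemma cst_simps:
  "cst (c + d) = cst c + cst d" "cst (c * d) = cst c * cst d" "cst 1 = 1"
  by (simp_all add: cst_def single_add mult_single)

instantiation witt :: (finite) lie_algebra
begin

lift_definition zero_witt :: "'a witt" is "\<lambda>_. 0"
  by (simp add: is_derivation_def)

lift_definition plus_witt :: "'a witt \<Rightarrow> 'a witt \<Rightarrow> 'a witt" is "\<lambda>D E p. D p + E p"
  by (simp add: is_derivation_iff algebra_simps)

lift_definition uminus_witt :: "'a witt \<Rightarrow> 'a witt" is "\<lambda>D p. - D p"
  by (simp add: is_derivation_iff algebra_simps)

lift_definition minus_witt :: "'a witt \<Rightarrow> 'a witt \<Rightarrow> 'a witt" is "\<lambda>D E p. D p - E p"
  by (simp add: is_derivation_iff algebra_simps)

lift_definition lie_scale_witt :: "complex \<Rightarrow> 'a witt \<Rightarrow> 'a witt" is "\<lambda>c D p. cst c * D p"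
  by (simp add: is_derivation_iff algebra_simps)

lift_definition lie_bracket_witt :: "'a witt \<Rightarrow> 'a witt \<Rightarrow> 'a witt"
  is "\<lambda>D E p. D (E p) - E (D p)"
  by (simp add: is_derivation_iff algebra_simps)

instance
proof
  fix x y z :: "'a witt" and c d :: complex
  note eqs = plus_witt.rep_eq zero_witt.rep_eq uminus_witt.rep_eq minus_witt.rep_eq
    lie_scale_witt.rep_eq lie_bracket_witt.rep_eq
  note dist = der_add der_diff der_uminus der_cst
  show "x + y + z = x + (y + z)" by (rule witt_eqI) (simp add: eqs)
  show "x + y = y + x" by (rule witt_eqI) (simp add: eqs)
  show "0 + x = x" by (rule witt_eqI) (simp add: eqs)
  show "- x + x = 0" by (rule witt_eqI) (simp add: eqs)
  show "x - y = x + - y" by (rule witt_eqI) (simp add: eqs)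
  show "lie_scale c (x + y) = lie_scale c x + lie_scale c y"
    by (rule witt_eqI) (simp add: eqs algebra_simps)
  show "lie_scale (c + d) x = lie_scale c x + lie_scale d x"
    by (rule witt_eqI) (simp add: eqs cst_simps algebra_simps)
  show "lie_scale c (lie_scale d x) = lie_scale (c * d) x"
    by (rule witt_eqI) (simp add: eqs cst_simps algebra_simps)
  show "lie_scale 1 x = x"
    by (rule witt_eqI) (simp add: eqs cst_simps)
  show "lie_bracket (x + y) z = lie_bracket x z + lie_bracket y z"
    by (rule witt_eqI) (simp add: eqs dist algebra_simps)
  show "lie_bracket x (y + z) = lie_bracket x y + lie_bracket x z"
    by (rule witt_eqI) (simp add: eqs dist algebra_simps)
  show "lie_bracket (lie_scale c x) y = lie_scale c (lie_bracket x y)"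
    by (rule witt_eqI) (simp add: eqs dist algebra_simps)
  show "lie_bracket x (lie_scale c y) = lie_scale c (lie_bracket x y)"
    by (rule witt_eqI) (simp add: eqs dist algebra_simps)
  show "lie_bracket x x = 0"
    by (rule witt_eqI) (simp add: eqs)
  show "lie_bracket x (lie_bracket y z) + lie_bracket y (lie_bracket z x)
          + lie_bracket z (lie_bracket x y) = 0"
    by (rule witt_eqI) (simp add: eqs dist algebra_simps)
qed

end

definition pol_mult :: "'n::finite pol \<Rightarrow> 'n witt \<Rightarrow> 'n witt"
  where "pol_mult f D = Abs_witt (\<lambda>p. f * der D p)"

lemma der_pol_mult: "der (pol_mult f D) p = f * der D p"
proof -
  have "is_derivation (\<lambda>p. f * der D p)"
    by (simp add: is_derivation_iff der_add der_const der_mult algebra_simps)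
  then show ?thesis
    by (simp add: pol_mult_def Abs_witt_inverse)
qed

text \<open>
  In the next definition, exponents are natural numbers and \<open>m - single i 1\<close> is truncated
  subtraction; when it truncates, the coefficient vanishes.
\<close>

definition pderiv :: "'n \<Rightarrow> 'n pol \<Rightarrow> 'n pol"
  where "pderiv i p = (\<Sum>m\<in>Poly_Mapping.keys p.
    Poly_Mapping.single (m - Poly_Mapping.single i 1)
      (of_nat (Poly_Mapping.lookup m i) * Poly_Mapping.lookup p m))"

lemma pderiv_add: "pderiv i (p + q) = pderiv i p + pderiv i q"
  unfolding pderiv_def
  by (rule setsum_keys_plus_distrib) (simp_all add: distrib_left single_add)

lemma pderiv_zero [simp]: "pderiv i 0 = 0"
  by (simp add: pderiv_def)

lemma pderiv_single:
  "pderiv i (Poly_Mapping.single m c)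
     = Poly_Mapping.single (m - Poly_Mapping.single i 1) (of_nat (Poly_Mapping.lookup m i) * c)"
  by (simp add: pderiv_def)

lemma shift_exponent:
  fixes m :: "'n \<Rightarrow>\<^sub>0 nat"
  assumes "0 < Poly_Mapping.lookup m i"
  shows "k + (m - Poly_Mapping.single i (Suc 0)) = k + m - Poly_Mapping.single i (Suc 0)"
  using assms by (auto intro!: poly_mapping_eqI simp: lookup_add lookup_minus lookup_single when_def)

lemma pderiv_mult: "pderiv i (p * q) = pderiv i p * q + p * pderiv i q"
proof (induction p rule: poly_mapping_additive_induct)
  case (single m c)
  show ?case
  proof (induction q rule: poly_mapping_additive_induct)
    case (single k d)
    show ?case
      by (cases "Poly_Mapping.lookup m i = 0"; cases "Poly_Mapping.lookup k i = 0")
         (simp_all add: mult_single pderiv_single shift_exponent lookup_add algebra_simps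
            flip: single_add)
  qed (simp_all add: pderiv_add algebra_simps)
qed (simp_all add: pderiv_add algebra_simps)

lift_definition partial :: "'n::finite \<Rightarrow> 'n witt" is pderiv
proof -
  fix i :: 'n
  have "pderiv i (cst c) = 0" for c
    by (simp add: cst_def pderiv_single)
  then show "is_derivation (pderiv i)"
    by (simp add: is_derivation_def pderiv_add pderiv_mult)
qed

definition hel :: "'n::finite \<Rightarrow> 'n witt"
  where "hel i = pol_mult (var i) (partial i)"

definition Delta :: "'n::finite witt set"
  where "Delta = lie.span (range partial)"

lemma der_hel_single:
  "der (hel i) (Poly_Mapping.single m c)
     = Poly_Mapping.single m (of_nat (Poly_Mapping.lookup m i) * c)"
proof (cases "Poly_Mapping.lookup m i = 0")
  case False
  then have "Poly_Mapping.single i 1 + (m - Poly_Mapping.single i 1) = m"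
    by (auto intro!: poly_mapping_eqI simp: lookup_add lookup_minus lookup_single when_def)
  then show ?thesis
    by (simp add: hel_def der_pol_mult partial.rep_eq pderiv_single var_def mult_single)
qed (simp add: hel_def der_pol_mult partial.rep_eq pderiv_single)

lemma bracket_hel: "lie_bracket (hel i) (hel j) = 0"
proof (rule witt_eqI)
  fix p
  have "der (hel i) (der (hel j) p) = der (hel j) (der (hel i) p)"
    by (induction p rule: poly_mapping_additive_induct)
       (simp_all add: der_hel_single der_add algebra_simps)
  then show "der (lie_bracket (hel i) (hel j)) p = der 0 p"
    by (simp add: lie_bracket_witt.rep_eq zero_witt.rep_eq)
qed

lemma lie_bracket_zero [simp]:
  fixes x :: "'g::lie_algebra"
  shows "lie_bracket 0 x = 0" "lie_bracket x 0 = 0"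
  using lie_bracket_add_left[of 0 0 x] lie_bracket_add_right[of x 0 0] by simp_all

lemma bracket_cartan:
  assumes "x \<in> lie.span (range hel)" "y \<in> lie.span (range hel)"
  shows "lie_bracket x y = 0"
proof -
  have "lie_bracket (hel i) y = 0" for i
    using assms(2)
    by (induction rule: lie.span_induct_alt)
       (auto simp: bracket_hel lie_bracket_add_right lie_bracket_scale_right)
  with assms(1) show ?thesis
    by (induction rule: lie.span_induct_alt)
       (auto simp: lie_bracket_add_left lie_bracket_scale_left)
qed

text \<open>The Cartan subalgebra, as a Lie algebra in its own right.\<close>

typedef (overloaded) 'n cartan = "lie.span (range hel) :: 'n::finite witt set"
  morphisms witt_of_cartan Abs_cartan
  by (rule exI[of _ 0]) (rule lie.span_zero)

setup_lifting type_definition_cartan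

lemma cartan_eqI: "witt_of_cartan x = witt_of_cartan y \<Longrightarrow> x = y"
  by (simp add: witt_of_cartan_inject)

instantiation cartan :: (finite) abelian_lie_algebra
begin

lift_definition zero_cartan :: "'a cartan" is 0
  by (rule lie.span_zero)

lift_definition plus_cartan :: "'a cartan \<Rightarrow> 'a cartan \<Rightarrow> 'a cartan" is "(+)"
  by (rule lie.span_add)

lift_definition uminus_cartan :: "'a cartan \<Rightarrow> 'a cartan" is uminus
  by (rule lie.span_neg)

lift_definition minus_cartan :: "'a cartan \<Rightarrow> 'a cartan \<Rightarrow> 'a cartan" is "(-)"
  by (rule lie.span_diff)

lift_definition lie_scale_cartan :: "complex \<Rightarrow> 'a cartan \<Rightarrow> 'a cartan" is lie_scale
  by (rule lie.span_scale)

lift_definition lie_bracket_cartan :: "'a cartan \<Rightarrow> 'a cartan \<Rightarrow> 'a cartan" is lie_bracket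
  by (simp add: bracket_cartan lie.span_zero)

instance
proof
  have abelian: "lie_bracket x y = 0" for x y :: "'a cartan"
    by transfer (rule bracket_cartan)
  show "lie_bracket x x = 0" for x :: "'a cartan"
    by (rule abelian)
  show "lie_bracket x y = 0" for x y :: "'a cartan"
    by (rule abelian)
qed (rule cartan_eqI,
    simp only: zero_cartan.rep_eq plus_cartan.rep_eq uminus_cartan.rep_eq minus_cartan.rep_eq
      lie_scale_cartan.rep_eq lie_bracket_cartan.rep_eq,
    rule add.assoc add.commute add_0_left left_minus diff_conv_add_uminus
      lie_scale_add lie_scale_add_left lie_scale_scale lie_scale_one
      lie_bracket_add_left lie_bracket_add_right lie_bracket_scale_left lie_bracket_scale_right
      lie_jacobi)+

end


section \<open>Whittaker modules\<close>

text \<open>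
  The linear form on \<open>Delta\<close> with value \<open>a i\<close> at \<open>partial i\<close>: the coefficient of \<open>partial i\<close> in an
  element \<open>x\<close> of \<open>Delta\<close> is the constant polynomial \<open>der x (var i)\<close>.
\<close>

definition phi :: "('n::finite \<Rightarrow> complex) \<Rightarrow> 'n witt \<Rightarrow> complex"
  where "phi a x = (\<Sum>i\<in>UNIV. Poly_Mapping.lookup (der x (var i)) 0 * a i)"

lemma phi_add: "phi a (x + y) = phi a x + phi a y"
  by (simp add: phi_def plus_witt.rep_eq lookup_add distrib_right sum.distrib)

lemma phi_scale:
  fixes x :: "'n::finite witt"
  shows "phi a (lie_scale c x) = c * phi a x"
proof -
  have "Poly_Mapping.lookup (cst c * p) 0 = c * Poly_Mapping.lookup p 0" for p :: "'n pol"
    by (simp add: cst_def Poly_Mapping.map_single flip: mult_map_scale_conv_mult)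
       (simp add: Poly_Mapping.map.rep_eq when_def)
  then show ?thesis
    by (simp add: phi_def lie_scale_witt.rep_eq sum_distrib_left mult.assoc)
qed

lemma phi_partial: "phi a (partial j) = a j"
proof -
  have "Poly_Mapping.lookup (der (partial j) (var i)) 0 = (if i = j then 1 else 0)" for i
    by (simp add: partial.rep_eq var_def pderiv_single lookup_single when_def)
  then have "phi a (partial j) = (\<Sum>i\<in>UNIV. if i = j then a i else 0)"
    unfolding phi_def by (intro sum.cong) simp_all
  then show ?thesis by simp
qed

definition whittaker ::
    "(complex \<Rightarrow> 'm::ab_group_add \<Rightarrow> 'm) \<Rightarrow> ('n::finite witt \<Rightarrow> 'm \<Rightarrow> 'm) \<Rightarrow> ('n witt \<Rightarrow> complex) \<Rightarrow> bool"
  where "whittaker scale act \<phi> \<longleftrightarrow>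
    (\<forall>v. \<exists>k::nat. \<forall>x\<in>Delta. ((\<lambda>w. act x w - scale (\<phi> x) w) ^^ k) v = 0)"

definition Wh ::
    "(complex \<Rightarrow> 'm::ab_group_add \<Rightarrow> 'm) \<Rightarrow> ('n::finite witt \<Rightarrow> 'm \<Rightarrow> 'm) \<Rightarrow> ('n \<Rightarrow> complex) \<Rightarrow> 'm set"
  where "Wh scale act a = {v. \<forall>i. act (partial i) v = scale (a i) v}"

definition finite_dimensional_subspace ::
    "(complex \<Rightarrow> 'm::ab_group_add \<Rightarrow> 'm) \<Rightarrow> 'm set \<Rightarrow> bool"
  where "finite_dimensional_subspace scale S \<longleftrightarrow>
    (\<exists>B. finite B \<and> \<not> module.dependent scale B \<and> module.span scale B = S)"

definition in_Omega ::
    "(complex \<Rightarrow> 'm::ab_group_add \<Rightarrow> 'm) \<Rightarrow> ('n::finite witt \<Rightarrow> 'm \<Rightarrow> 'm) \<Rightarrow> ('n \<Rightarrow> complex) \<Rightarrow> bool"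
  where "in_Omega scale act a \<longleftrightarrow> lie_module scale act \<and> whittaker scale act (phi a) \<and>
    finite_dimensional_subspace scale (Wh scale act a)"

definition trivial_module :: "('n::finite witt \<Rightarrow> 'm::ab_group_add \<Rightarrow> 'm) \<Rightarrow> bool"
  where "trivial_module act \<longleftrightarrow> (\<forall>x v. act x v = 0)"

definition restrict_cartan :: "('n::finite witt \<Rightarrow> 'm \<Rightarrow> 'm) \<Rightarrow> 'n cartan \<Rightarrow> 'm \<Rightarrow> 'm"
  where "restrict_cartan act h = act (witt_of_cartan h)"

end

(*
  Only the partial derivatives p_i and the h_i matter, with [p_i, h_j] = delta_ij p_i.  Hence p_i
  moves past a polynomial in h_1, ..., h_n by the shift h_i -> h_i + 1, and on f(h) v, for a
  Whittaker vector v, the locally nilpotent operator p_i - a_i acts as a_i times the forward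
  difference of f in h_i.  So a C-basis of the Whittaker vectors is a basis over U(h): a relation
  of minimal degree is killed by all differences, and polynomials have antidifferences, which lets
  one peel off nilpotency one variable at a time.  Working with falling factorials, the difference
  calculus takes place inside M, and all that is used of U(h) is that the h_i generate it; no
  Poincare-Birkhoff-Witt theorem is needed.
*)

theory Submission
  imports Defs
begin

section \<open>Abstract setting: a commutative ring of operators and their shifts\<close>

lemma sum_fun_upd_Suc:
  fixes m :: "'n::finite \<Rightarrow> nat"
  shows "sum (m(i := Suc (m i))) UNIV = Suc (sum m UNIV)"
proof -
  have "sum (m(i := Suc (m i))) UNIV = Suc (m i) + sum (m(i := Suc (m i))) (UNIV - {i})"
    by (subst sum.remove[of _ i]) simp_all
  also have "sum (m(i := Suc (m i))) (UNIV - {i}) = sum m (UNIV - {i})"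
    by (rule sum.cong) auto
  finally show ?thesis
    by (simp add: sum.remove[of UNIV i m])
qed

text \<open>\<open>'r\<close> stands for U(h_n), with \<open>H i\<close> for h_i and
  \<open>sc\<close> for the embedding of the complex numbers; \<open>P i\<close> stands for the
  action of the i-th partial derivative. \<open>generated\<close> expresses generation by the
  \<open>H i\<close> as an induction rule. \<open>P_H_same\<close> is the bracket relation
  [p_i, h_i] = p_i, read as a shift.\<close>

locale shift_module = R: module act + C: vector_space scale
  for act :: "'r::comm_ring_1 \<Rightarrow> 'm::ab_group_add \<Rightarrow> 'm"
    and scale :: "complex \<Rightarrow> 'm \<Rightarrow> 'm" +
  fixes sc :: "complex \<Rightarrow> 'r"
    and H :: "'n::finite \<Rightarrow> 'r"
    and P :: "'n \<Rightarrow> 'm \<Rightarrow> 'm"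
    and a :: "'n \<Rightarrow> complex"
  assumes act_sc: "act (sc c) v = scale c v"
    and sc_add: "sc (c + d) = sc c + sc d"
    and sc_mult: "sc (c * d) = sc c * sc d"
    and sc_one: "sc 1 = 1"
    and generated: "\<And>Q u. \<lbrakk>\<And>c. Q (sc c); \<And>p q. Q p \<Longrightarrow> Q q \<Longrightarrow> Q (p + q);
           \<And>c p. Q p \<Longrightarrow> Q (sc c * p); \<And>i p. Q p \<Longrightarrow> Q (H i * p)\<rbrakk> \<Longrightarrow> Q u"
    and P_add: "P i (v + w) = P i v + P i w"
    and P_scale: "P i (scale c v) = scale c (P i v)"
    and P_commute: "P i (P j v) = P j (P i v)"
    and P_H_other: "i \<noteq> j \<Longrightarrow> P i (act (H j) v) = act (H j) (P i v)"
    and P_H_same: "P i (act (H i) v) = act (H i + 1) (P i v)"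
    and a_nonzero: "a i \<noteq> 0"
    and nilpotent: "\<exists>k. ((\<lambda>w. P i w - scale (a i) w) ^^ k) v = 0"
begin

section \<open>Difference calculus with falling factorials\<close>

definition D :: "'n \<Rightarrow> 'm \<Rightarrow> 'm"
  where "D i v = P i v - scale (a i) v"

text \<open>The falling factorial of length \<open>k\<close> in \<open>H i\<close>. Forward
  differences act on these as differentiation acts on powers.\<close>

definition ffact :: "'n \<Rightarrow> nat \<Rightarrow> 'r"
  where "ffact i k = (\<Prod>l<k. H i - of_nat l)"

definition ffact_prod :: "('n \<Rightarrow> nat) \<Rightarrow> 'r"
  where "ffact_prod m = (\<Prod>i\<in>UNIV. ffact i (m i))"

lemma sc_zero: "sc 0 = 0"
  using sc_add[of 0 0] by simp

lemma sc_of_nat: "sc (of_nat k) = of_nat k"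
  by (induction k) (simp_all add: sc_zero sc_add sc_one)

lemma act_of_nat: "act (of_nat k) v = scale (of_nat k) v"
  by (metis act_sc sc_of_nat)

lemma act_scale: "act u (scale c v) = scale c (act u v)"
  by (simp add: mult.commute flip: act_sc)

lemma D_add: "D i (v + w) = D i v + D i w"
  by (simp add: D_def P_add C.scale_right_distrib)

lemma D_scale: "D i (scale c v) = scale c (D i v)"
  by (simp add: D_def P_scale C.scale_right_diff_distrib mult.commute)

lemma D_zero: "D i 0 = 0"
  using D_scale[of i 0 0] by simp

lemma D_diff: "D i (v - w) = D i v - D i w"
  using D_add[of i "v - w" w] by simp

lemma D_sum: "D i (sum f A) = (\<Sum>x\<in>A. D i (f x))"
  by (induction A rule: infinite_finite_induct) (simp_all add: D_zero D_add)

lemma P_diff: "P i (v - w) = P i v - P i w"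
  using P_add[of i "v - w" w] by simp

lemma D_commute: "D i (D j v) = D j (D i v)"
  by (simp add: D_def P_diff P_scale C.scale_right_diff_distrib P_commute[of i j] mult.commute)

lemma P_eq: "P i v = D i v + scale (a i) v"
  by (simp add: D_def)

text \<open>Every factor passes \<open>P i\<close> at the price of the shift \<open>H i\<close> to
  \<open>H i + 1\<close>. The induction is over all \<open>v\<close>, since one factor is first
  absorbed into the vector.\<close>

lemma P_ffact_same: "P i (act (ffact i k) v) = act (\<Prod>l<k. H i + 1 - of_nat l) (P i v)"
proof (induction k arbitrary: v)
  case 0
  show ?case by (simp add: ffact_def)
next
  case (Suc k)
  have linear: "P i (act (H i - of_nat l) v) = act (H i + 1 - of_nat l) (P i v)" for l v
    by (simp only: R.scale_left_diff_distrib P_diff P_H_same act_of_nat P_scale)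
  have "P i (act (ffact i (Suc k)) v) = P i (act (ffact i k) (act (H i - of_nat k) v))"
    by (simp add: ffact_def)
  also have "\<dots> = act (\<Prod>l<Suc k. H i + 1 - of_nat l) (P i v)"
    by (subst Suc.IH) (simp add: linear)
  finally show ?case .
qed

lemma P_ffact_other: "i \<noteq> j \<Longrightarrow> P i (act (ffact j k) v) = act (ffact j k) (P i v)"
proof (induction k arbitrary: v)
  case 0
  show ?case by (simp add: ffact_def)
next
  case (Suc k)
  have linear: "P i (act (H j - of_nat l) v) = act (H j - of_nat l) (P i v)" for l v
    by (simp only: R.scale_left_diff_distrib P_diff P_H_other[OF Suc.prems] act_of_nat P_scale)
  have ffact: "act (ffact j (Suc k)) v = act (ffact j k) (act (H j - of_nat k) v)" for v
    by (simp add: ffact_def)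
  show ?case
    by (simp only: ffact Suc.IH[OF Suc.prems] linear)
qed

lemma D_ffact_other: "i \<noteq> j \<Longrightarrow> D i (act (ffact j k) v) = act (ffact j k) (D i v)"
  by (simp add: D_def P_ffact_other R.scale_right_diff_distrib act_scale)

text \<open>Pulling out the first factor \<open>H i + 1\<close> leaves
  \<open>ffact i (k - 1)\<close>, and \<open>H i + 1\<close> is \<open>H i - (k - 1)\<close> plus
  \<open>k\<close>. For \<open>k = 0\<close> the truncated \<open>k - 1\<close> is harmless, its
  coefficient being zero.\<close>

lemma ffact_shift: "(\<Prod>l<k. H i + 1 - of_nat l) = ffact i k + of_nat k * ffact i (k - 1)"
proof (cases k)
  case 0
  then show ?thesis by (simp add: ffact_def)
next
  case (Suc k')
  have "(\<Prod>l<Suc k'. H i + 1 - of_nat l) = (H i + 1) * ffact i k'"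
    by (simp add: prod.lessThan_Suc_shift ffact_def del: prod.lessThan_Suc)
  also have "\<dots> = ffact i (Suc k') + of_nat (Suc k') * ffact i k'"
    by (simp add: ffact_def algebra_simps)
  finally show ?thesis by (simp add: Suc)
qed

text \<open>Here \<open>v\<close> is an eigenvector of \<open>P i\<close> with eigenvalue
  \<open>a i\<close>, so subtracting \<open>a i\<close> cancels the unshifted falling factorial and
  leaves \<open>a i\<close> times its forward difference.\<close>

lemma D_ffact_same:
  assumes "D i v = 0"
  shows "D i (act (ffact i k) v) = scale (a i * of_nat k) (act (ffact i (k - 1)) v)"
proof -
  have "P i (act (ffact i k) v) = act (ffact i k + of_nat k * ffact i (k - 1)) (scale (a i) v)"
    by (simp only: P_ffact_same ffact_shift) (simp add: P_eq assms)
  also have "\<dots> = scale (a i) (act (ffact i k) v) + scale (a i * of_nat k) (act (ffact i (k - 1)) v)"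
    by (simp add: act_scale R.scale_left_distrib C.scale_right_distrib act_of_nat
        flip: R.scale_scale)
  finally show ?thesis by (simp add: D_def)
qed

text \<open>The factors with index other than \<open>i\<close> commute with \<open>D i\<close>, so
  only the one in \<open>H i\<close> is differenced.\<close>

lemma D_ffact_prod:
  assumes "\<And>i. D i v = 0"
  shows "D i (act (ffact_prod m) v) = scale (a i * of_nat (m i)) (act (ffact_prod (m(i := m i - 1))) v)"
proof -
  define g where "g = (\<Prod>j\<in>UNIV - {i}. ffact j (m j))"
  have other: "D i (act (\<Prod>j\<in>J. ffact j (m j)) w) = act (\<Prod>j\<in>J. ffact j (m j)) (D i w)"
    if "i \<notin> J" for J w
    using finite[of J] that
  proof (induction J arbitrary: w)
    case (insert j J)
    then have "i \<noteq> j" "i \<notin> J" by auto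
    with insert show ?case
      by (simp add: D_ffact_other flip: R.scale_scale)
  qed simp
  have ffact_prod: "ffact_prod m = g * ffact i (m i)"
    unfolding ffact_prod_def g_def by (subst prod.remove[of _ i]) (simp_all add: mult.commute)
  have ffact_prod': "ffact_prod (m(i := k)) = g * ffact i k" for k
    unfolding ffact_prod_def g_def by (subst prod.remove[of _ i]) (simp_all add: mult.commute)
  have "D i (act (ffact_prod m) v) = act g (D i (act (ffact i (m i)) v))"
    unfolding ffact_prod R.scale_scale[symmetric] g_def by (rule other) simp
  also have "\<dots> = scale (a i * of_nat (m i)) (act (ffact_prod (m(i := m i - 1))) v)"
    by (simp add: D_ffact_same assms ffact_prod' act_scale)
  finally show ?thesis .
qed

lemma ffact_prod_zero: "ffact_prod (\<lambda>_. 0) = 1"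
  by (simp add: ffact_prod_def ffact_def)

text \<open>Splitting \<open>H i\<close> as \<open>H i - m i\<close> plus \<open>m i\<close>, the
  first summand lengthens the falling factorial by one factor. Hence the span of the
  \<open>ffact_prod m\<close> is stable under the \<open>H i\<close>.\<close>

lemma H_mult_ffact_prod: "H i * ffact_prod m = ffact_prod (m(i := Suc (m i))) + of_nat (m i) * ffact_prod m"
proof -
  define g where "g = (\<Prod>j\<in>UNIV - {i}. ffact j (m j))"
  have ffact_prod: "ffact_prod m = ffact i (m i) * g"
    unfolding ffact_prod_def g_def by (subst prod.remove[of _ i]) simp_all
  have ffact_prod': "ffact_prod (m(i := k)) = ffact i k * g" for k
    unfolding ffact_prod_def g_def by (subst prod.remove[of _ i]) simp_all
  show ?thesis
    unfolding ffact_prod ffact_prod' by (simp add: ffact_def algebra_simps)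
qed

section \<open>Newton expansions of ring elements\<close>

definition newton :: "(('n \<Rightarrow> nat) \<Rightarrow>\<^sub>0 complex) \<Rightarrow> 'r"
  where "newton p = (\<Sum>m\<in>Poly_Mapping.keys p. sc (Poly_Mapping.lookup p m) * ffact_prod m)"

lemma newton_add: "newton (p + q) = newton p + newton q"
  unfolding newton_def
  by (rule setsum_keys_plus_distrib) (simp_all add: sc_zero sc_add distrib_right)

lemma newton_single: "newton (Poly_Mapping.single m c) = sc c * ffact_prod m"
  by (simp add: newton_def sc_zero)

text \<open>The image of \<open>newton\<close> contains the scalars and is closed under sums and
  under multiplication by scalars and by each \<open>H i\<close>, so \<open>generated\<close>
  applies.\<close>

lemma newton_surj: "\<exists>p. u = newton p"
proof (rule generated[of "\<lambda>u. \<exists>p. u = newton p"])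
  show "\<exists>p. sc c = newton p" for c
    by (rule exI[of _ "Poly_Mapping.single (\<lambda>_. 0) c"]) (simp add: newton_single ffact_prod_zero)
next
  fix p q
  assume "\<exists>p'. p = newton p'" "\<exists>q'. q = newton q'"
  then obtain p' q' where "p = newton p'" "q = newton q'"
    by blast
  then have "p + q = newton (p' + q')"
    by (simp add: newton_add)
  then show "\<exists>r. p + q = newton r" ..
next
  fix c u
  assume "\<exists>p. u = newton p"
  then obtain p where "u = newton p" ..
  moreover have "\<exists>q. sc c * newton p = newton q"
  proof (induction p rule: poly_mapping_additive_induct)
    case zero
    show ?case by (rule exI[of _ 0]) (simp add: newton_def)
  next
    case (single m d)
    show ?case
      by (rule exI[of _ "Poly_Mapping.single m (c * d)"]) (simp add: newton_single sc_mult)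
  next
    case (add p q)
    then obtain p' q' where "sc c * newton p = newton p'" "sc c * newton q = newton q'"
      by blast
    then have "sc c * newton (p + q) = newton (p' + q')"
      by (simp add: newton_add distrib_left)
    then show ?case ..
  qed
  ultimately show "\<exists>q. sc c * u = newton q" by simp
next
  fix i u
  assume "\<exists>p. u = newton p"
  then obtain p where "u = newton p" ..
  moreover have "\<exists>q. H i * newton p = newton q"
  proof (induction p rule: poly_mapping_additive_induct)
    case zero
    show ?case by (rule exI[of _ 0]) (simp add: newton_def)
  next
    case (single m d)
    have "H i * newton (Poly_Mapping.single m d) = sc d * (H i * ffact_prod m)"
      by (simp add: newton_single algebra_simps)
    also have "\<dots> = newton (Poly_Mapping.single (m(i := Suc (m i))) d
        + Poly_Mapping.single m (d * of_nat (m i)))"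
      by (simp add: newton_add newton_single H_mult_ffact_prod sc_mult sc_of_nat algebra_simps)
    finally show ?case ..
  next
    case (add p q)
    then obtain p' q' where "H i * newton p = newton p'" "H i * newton q = newton q'"
      by blast
    then have "H i * newton (p + q) = newton (p' + q')"
      by (simp add: newton_add distrib_left)
    then show ?case ..
  qed
  ultimately show "\<exists>q. H i * u = newton q" by simp
qed

section \<open>Independence of falling factorials over Whittaker vectors\<close>

text \<open>Strong induction on a bound \<open>N\<close> for the total degree. Applying
  \<open>D i\<close> gives a relation of smaller degree, which kills every coefficient whose
  exponent is positive in direction \<open>i\<close>; only the constant term survives, and the
  relation itself then says that it vanishes.\<close>

lemma ffact_prod_independent:
  assumes "finite A" "\<And>m i. D i (v m) = 0" "(\<Sum>m\<in>A. act (ffact_prod m) (v m)) = 0" "m \<in> A"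
  shows "v m = 0"
proof -
  have "\<forall>m\<in>A. v m = 0" if "\<And>m. m \<in> A \<Longrightarrow> sum m UNIV \<le> N" for N
    using that assms(1-3)
  proof (induction N arbitrary: A v rule: less_induct)
    case (less N)
    have nonconst: "v m = 0" if "m \<in> A" "m i > 0" for m i
    proof -
      define up where "up m = m(i := Suc (m i))" for m :: "'n \<Rightarrow> nat"
      define down where "down m = m(i := m i - 1)" for m :: "'n \<Rightarrow> nat"
      define A' where "A' = {m. up m \<in> A}"
      \<comment> \<open>The factor produced by \<open>D i\<close> is moved into the coefficient, so
        that the differenced relation has the same shape as the original one.\<close>
      define v' where "v' m = scale (a i * of_nat (Suc (m i))) (v (up m))" for m
      have down_up: "down (up m) = m" for m
        by (simp add: up_def down_def)
      have up_down: "up (down m) = m" if "m i > 0" for m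
        using that by (simp add: up_def down_def)
      have degree: "sum (up m) UNIV = Suc (sum m UNIV)" for m
        unfolding up_def by (rule sum_fun_upd_Suc)
      \<comment> \<open>Since \<open>m i > 0\<close>, the bound \<open>N\<close> is positive and the
        truncated \<open>N - 1\<close> is really smaller.\<close>
      have "Suc (sum (down m) UNIV) \<le> N"
        using less.prems(1)[OF that(1)] degree[of "down m"] up_down[of m, OF that(2)] by simp
      then have N: "N - 1 < N" by simp
      have fin: "finite A'"
      proof (rule finite_subset)
        show "A' \<subseteq> down ` A"
        proof
          fix m assume "m \<in> A'"
          then show "m \<in> down ` A"
            unfolding A'_def by (intro image_eqI[of _ _ "up m"]) (simp_all add: down_up)
        qed
      qed (use less.prems in simp)
      have "0 = D i (\<Sum>m\<in>A. act (ffact_prod m) (v m))"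
        by (simp add: less.prems D_zero)
      also have "\<dots> = (\<Sum>m\<in>A. scale (a i * of_nat (m i)) (act (ffact_prod (down m)) (v m)))"
        unfolding D_sum down_def by (simp add: D_ffact_prod less.prems(3))
      \<comment> \<open>Terms with \<open>m i = 0\<close> carry the factor zero; on the others
        \<open>up\<close> inverts \<open>down\<close>, which allows reindexing by
        \<open>A'\<close>.\<close>
      also have "\<dots> = (\<Sum>m\<in>{m \<in> A. m i > 0}. scale (a i * of_nat (m i)) (act (ffact_prod (down m)) (v m)))"
        by (rule sum.mono_neutral_right) (auto simp: less.prems)
      also have "\<dots> = (\<Sum>m\<in>A'. act (ffact_prod m) (v' m))"
      proof (rule sum.reindex_bij_witness[of _ up down])
        fix m assume "m \<in> {m \<in> A. m i > 0}"
        then have m: "up (down m) = m" "Suc (down m i) = m i" "m \<in> A"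
          using up_down[of m] by (auto simp: down_def)
        then show "up (down m) = m" "down m \<in> A'"
          by (simp_all add: A'_def)
        show "act (ffact_prod (down m)) (v' (down m)) = scale (a i * of_nat (m i)) (act (ffact_prod (down m)) (v m))"
          unfolding v'_def m act_scale ..
      next
        fix m assume "m \<in> A'"
        then show "down (up m) = m" "up m \<in> {m \<in> A. m i > 0}"
          by (simp_all add: down_up A'_def) (simp add: up_def)
      qed
      finally have "(\<Sum>m\<in>A'. act (ffact_prod m) (v' m)) = 0" ..
      moreover have "sum m UNIV \<le> N - 1" if "m \<in> A'" for m
        using that less.prems(1)[of "up m"] degree[of m] by (simp add: A'_def)
      ultimately have "\<forall>m\<in>A'. v' m = 0"
        using less.IH[of "N - 1" A' v'] N fin less.prems(3) by (simp add: v'_def D_scale)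
      moreover have "down m \<in> A'"
        using that up_down by (simp add: A'_def)
      \<comment> \<open>This vector is \<open>v m\<close> times \<open>a i * m i\<close>, a nonzero
        number.\<close>
      ultimately have "v' (down m) = 0" by blast
      then show "v m = 0"
        using that a_nonzero[of i] up_down[of m]
        by (simp add: v'_def del: of_nat_Suc)
    qed
    show ?case
    proof
      fix m assume "m \<in> A"
      show "v m = 0"
      proof (cases "m = (\<lambda>_. 0)")
        case False
        then show ?thesis using nonconst[OF \<open>m \<in> A\<close>] by (auto simp: fun_eq_iff)
      next
        case True
        have "(\<Sum>m\<in>A. act (ffact_prod m) (v m)) = (\<Sum>m\<in>{\<lambda>_. 0}. act (ffact_prod m) (v m))"
        proof (rule sum.mono_neutral_right)
          show "\<forall>m\<in>A - {\<lambda>_. 0}. act (ffact_prod m) (v m) = 0"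
            using nonconst by (fastforce simp: fun_eq_iff)
        qed (use True \<open>m \<in> A\<close> less.prems in auto)
        then show ?thesis
          using True less.prems(4) by (simp add: ffact_prod_zero)
      qed
    qed
  qed
  from this[of "Max ((\<lambda>m. sum m UNIV) ` A)"] show ?thesis
    using assms by simp
qed

section \<open>Generation by Whittaker vectors through antidifferences\<close>

text \<open>
  An element killed by a power of \<open>D j\<close> is corrected by an antidifference,
  read off from \<open>D j (act (ffact j (Suc l)) v) = scale (a j * Suc l) (act (ffact j l) v)\<close>.
\<close>

lemma kernel_expansion:
  assumes "(D j ^^ k) w = 0" "\<And>i. i \<in> I \<Longrightarrow> D i w = 0" "j \<notin> I"
  shows "\<exists>v. (\<forall>l. \<forall>i\<in>insert j I. D i (v l) = 0) \<and> w = (\<Sum>l<k. act (ffact j l) (v l))"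
  using assms(1,2)
proof (induction k arbitrary: w)
  case 0
  then show ?case by (intro exI[of _ "\<lambda>_. 0"]) (simp add: D_zero)
next
  case (Suc k)
  have "(D j ^^ k) (D j w) = 0"
    using Suc.prems(1) by (simp add: funpow_swap1)
  moreover have "D i (D j w) = 0" if "i \<in> I" for i
    using Suc.prems(2)[OF that] D_commute[of i j w] by (simp add: D_zero)
  ultimately obtain v where v: "\<And>l i. i \<in> insert j I \<Longrightarrow> D i (v l) = 0"
    and Dw: "D j w = (\<Sum>l<k. act (ffact j l) (v l))"
    using Suc.IH[of "D j w"] by blast
  \<comment> \<open>Dividing by the factor that \<open>D j\<close> will produce turns the terms of
    \<open>D j w\<close> into antidifferences. What remains of \<open>w\<close> after subtracting
    them is \<open>z\<close>, which \<open>D j\<close> kills; it becomes the coefficient of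
    \<open>ffact j 0 = 1\<close>.\<close>
  define u where "u l = scale (inverse (a j * of_nat (Suc l))) (v l)" for l
  define z where "z = w - (\<Sum>l<k. act (ffact j (Suc l)) (u l))"
  have Du: "D i (u l) = 0" if "i \<in> insert j I" for i l
    using v[OF that] by (simp add: u_def D_scale)
  have "D j (act (ffact j (Suc l)) (u l)) = act (ffact j l) (v l)" for l
    using a_nonzero[of j] D_ffact_same[OF Du[of j l], of "Suc l"]
    by (simp add: u_def act_scale divide_simps del: of_nat_Suc)
  then have "D j z = 0"
    by (simp add: z_def D_diff D_sum Dw)
  moreover have "D i z = 0" if "i \<in> I" for i
  proof -
    have "i \<noteq> j"
      using that assms(3) by blast
    have "D i (act (ffact j (Suc l)) (u l)) = 0" for l
      unfolding D_ffact_other[OF \<open>i \<noteq> j\<close>] Du[OF insertI2[OF that]] by (rule R.scale_zero_right)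
    then show ?thesis
      by (simp add: z_def D_diff D_sum Suc.prems(2)[OF that])
  qed
  ultimately have "\<forall>l. \<forall>i\<in>insert j I. D i ((case l of 0 \<Rightarrow> z | Suc l \<Rightarrow> u l)) = 0"
    using Du by (auto split: nat.split)
  moreover have "w = (\<Sum>l<Suc k. act (ffact j l) (case l of 0 \<Rightarrow> z | Suc l \<Rightarrow> u l))"
    by (simp add: sum.lessThan_Suc_shift z_def ffact_def del: sum.lessThan_Suc)
  ultimately show ?case
    by (intro exI[of _ "\<lambda>l. case l of 0 \<Rightarrow> z | Suc l \<Rightarrow> u l"]) simp
qed

text \<open>Induction on a finite set \<open>S\<close> such that \<open>D i\<close> kills
  \<open>w\<close> for all \<open>i\<close> outside \<open>S\<close>. Expanding \<open>w\<close> in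
  one direction \<open>j\<close> of \<open>S\<close> gives coefficients that \<open>D j\<close>
  kills as well, so these are covered by a smaller set. For \<open>S\<close> empty the vector lies
  in the kernel, and \<open>S = UNIV\<close> imposes no condition.\<close>

lemma in_submodule:
  assumes N: "R.subspace N" and kernel: "{v. \<forall>i. D i v = 0} \<subseteq> N"
  shows "w \<in> N"
proof -
  have "w \<in> N" if "\<And>i. i \<notin> S \<Longrightarrow> D i w = 0" for S w
    using finite[of S] that
  proof (induction S arbitrary: w)
    case empty
    then show ?case using kernel by auto
  next
    case (insert j S)
    have "D j = (\<lambda>w. P j w - scale (a j) w)"
      by (simp add: D_def fun_eq_iff)
    then obtain k where "(D j ^^ k) w = 0"
      using nilpotent[of j w] by auto
    then have "\<exists>v. (\<forall>l. \<forall>i\<in>insert j (- insert j S). D i (v l) = 0) \<and> w = (\<Sum>l<k. act (ffact j l) (v l))"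
    proof (rule kernel_expansion)
      show "D i w = 0" if "i \<in> - insert j S" for i
        using insert.prems that by blast
    qed blast
    then obtain v where v: "\<forall>l. \<forall>i\<in>insert j (- insert j S). D i (v l) = 0"
      and w: "w = (\<Sum>l<k. act (ffact j l) (v l))"
      by (elim exE conjE)
    have "v l \<in> N" for l
    proof (rule insert.IH)
      show "D i (v l) = 0" if "i \<notin> S" for i
        using v that by (cases "i = j") auto
    qed
    then show ?case
      unfolding w by (auto intro!: R.subspace_sum[OF N] R.subspace_scale[OF N])
  qed
  from this[of UNIV] show ?thesis by simp
qed

section \<open>A complex basis of the kernel is a basis over the ring\<close>

text \<open>A relation over \<open>'r\<close> is regrouped by exponents: the coefficient of each
  \<open>ffact_prod m\<close> is a complex combination of \<open>B\<close>, hence in the kernel,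
  hence zero, and complex independence finishes. For spanning, the ring span of \<open>B\<close> is
  a submodule containing the kernel.\<close>

lemma free_over_kernel:
  assumes fin: "finite B" and indep: "\<not> C.dependent B"
    and span: "C.span B = {v. \<forall>i. P i v = scale (a i) v}"
  shows "\<not> R.dependent B" and "R.span B = UNIV"
proof -
  have kernel: "{v. \<forall>i. P i v = scale (a i) v} = {v. \<forall>i. D i v = 0}"
    by (simp add: D_def)
  have B: "D i b = 0" if "b \<in> B" for b i
    using C.span_base[OF that] span kernel by blast
  show "\<not> R.dependent B"
  proof
    assume "R.dependent B"
    then obtain t u b where t: "t \<subseteq> B" "(\<Sum>v\<in>t. act (u v) v) = 0" and b: "b \<in> t" "u b \<noteq> 0"
      unfolding R.dependent_explicit by blast
    then have "finite t"
      using fin finite_subset by blast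
    have "\<exists>p. \<forall>b. u b = newton (p b)"
      by (intro choice allI newton_surj)
    then obtain p where p: "\<And>b. u b = newton (p b)"
      by blast
    define A where "A = (\<Union>b\<in>t. Poly_Mapping.keys (p b))"
    define v where "v m = (\<Sum>b\<in>t. scale (Poly_Mapping.lookup (p b) m) b)" for m
    have finA: "finite A"
      using \<open>finite t\<close> by (simp add: A_def)
    \<comment> \<open>Passing from the keys of \<open>p b\<close> to the common index set
      \<open>A\<close> adds only zero terms, and makes the two sums interchangeable.\<close>
    have u: "u b = (\<Sum>m\<in>A. sc (Poly_Mapping.lookup (p b) m) * ffact_prod m)" if "b \<in> t" for b
      unfolding p newton_def using that finA
      by (intro sum.mono_neutral_left) (auto simp: A_def in_keys_iff sc_zero)
    have "(\<Sum>v\<in>t. act (u v) v)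
        = (\<Sum>b\<in>t. \<Sum>m\<in>A. act (ffact_prod m) (scale (Poly_Mapping.lookup (p b) m) b))"
      by (intro sum.cong refl)
         (simp add: u R.scale_sum_left act_scale act_sc flip: R.scale_scale)
    also have "\<dots> = (\<Sum>m\<in>A. act (ffact_prod m) (v m))"
      by (subst sum.swap) (simp add: v_def R.scale_sum_right)
    finally have sum: "(\<Sum>m\<in>A. act (ffact_prod m) (v m)) = 0"
      using t by simp
    have "D i (v m) = 0" for i m
      unfolding v_def using t B by (auto simp: D_sum D_scale intro!: sum.neutral)
    then have v: "v m = 0" if "m \<in> A" for m
      using ffact_prod_independent[OF finA _ sum that] by simp
    have coeff: "Poly_Mapping.lookup (p b) m = 0" if "m \<in> A" for m
      using C.independentD[OF indep \<open>finite t\<close> t(1) v[OF that, unfolded v_def] b(1)] .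
    have "u b = 0"
      unfolding u[OF b(1)] by (intro sum.neutral) (simp add: sc_zero coeff)
    with b show False by simp
  qed
  \<comment> \<open>Complex scalars act through \<open>sc\<close>, so complex combinations are ring
    combinations.\<close>
  have "C.span B \<subseteq> R.span B"
  proof
    fix v assume "v \<in> C.span B"
    then show "v \<in> R.span B"
    proof (induction rule: C.span_induct_alt)
      case (step c x y)
      then show ?case
        by (simp add: R.span_add R.span_base R.span_scale flip: act_sc)
    qed (rule R.span_zero)
  qed
  then show "R.span B = UNIV"
    using in_submodule[OF R.subspace_span, of B] span kernel by auto
qed

end

section \<open>Brackets of partial derivatives and Cartan elements\<close>

lemma lookup_minus_single:
  "Poly_Mapping.lookup (m - Poly_Mapping.single i (1::nat)) j
     = Poly_Mapping.lookup m j - (if i = j then 1 else 0)"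
  by (simp add: lookup_minus lookup_single when_def)

text \<open>On a monomial, \<open>hel j\<close> reads off the exponent of t_j, which
  \<open>partial i\<close> lowers by one exactly when \<open>i = j\<close>. Monomials without t_i
  are treated apart because exponent subtraction truncates.\<close>

lemma bracket_partial_hel:
  "lie_bracket (partial i) (hel j) = (if i = j then partial i else 0)"
proof (rule witt_eqI)
  fix p
  have "pderiv i (der (hel j) p) - der (hel j) (pderiv i p) = (if i = j then pderiv i p else 0)"
  proof (induction p rule: poly_mapping_additive_induct)
    case (single m c)
    show ?case
    proof (cases "Poly_Mapping.lookup m i")
      case 0
      then show ?thesis
        by (cases "i = j") (simp_all add: der_hel_single pderiv_single)
    next
      case (Suc k)
      then show ?thesis
        by (cases "i = j") (simp_all add: der_hel_single pderiv_single lookup_minus_single[simplified]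
            algebra_simps flip: single_add single_diff)
    qed
  qed (simp_all add: pderiv_add der_add algebra_simps split: if_splits)
  then show "der (lie_bracket (partial i) (hel j)) p = der (if i = j then partial i else 0) p"
    by (simp add: lie_bracket_witt.rep_eq zero_witt.rep_eq partial.rep_eq)
qed

lemma bracket_partial: "lie_bracket (partial i) (partial j) = 0"
proof (rule witt_eqI)
  fix p
  have "pderiv i (pderiv j p) = pderiv j (pderiv i p)"
  proof (induction p rule: poly_mapping_additive_induct)
    case (single m c)
    have "m - Poly_Mapping.single i 1 - Poly_Mapping.single j 1
        = m - Poly_Mapping.single j 1 - Poly_Mapping.single i (1::nat)"
      by (simp add: diff_diff_add add.commute)
    then show ?case
      by (cases "i = j") (simp_all add: pderiv_single lookup_minus_single[simplified] mult.left_commute)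
  qed (simp_all add: pderiv_add)
  then show "der (lie_bracket (partial i) (partial j)) p = der 0 p"
    by (simp add: lie_bracket_witt.rep_eq zero_witt.rep_eq partial.rep_eq)
qed

section \<open>Generation of the enveloping algebra of the Cartan subalgebra\<close>

lemma abs_uea_eqI: "f - g \<in> env_ideal \<Longrightarrow> abs_uea f = abs_uea g"
  using Quotient3_rel_abs[OF Quotient3_uea] by (simp add: env_eq_def)

lemma uea_letter_add: "abs_uea (letter (x + y)) = abs_uea (letter x) + abs_uea (letter y)"
  unfolding plus_uea.abs_eq
  by (rule abs_uea_eqI) (metis diff_diff_eq env_letter_add)

lemma uea_letter_scale:
  "abs_uea (letter (lie_scale c x)) = abs_uea (scalar c) * abs_uea (letter x)"
  unfolding times_uea.abs_eq by (rule abs_uea_eqI) (rule env_letter_scale)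

text \<open>Elements are sums of words, words are products of letters, and letters are linear
  combinations of the h_i. This supplies \<open>generated\<close>.\<close>

lemma uea_cartan_induct:
  fixes u :: "'n::finite cartan uea"
  assumes scalar: "\<And>c. Q (abs_uea (scalar c))"
    and add: "\<And>p q. Q p \<Longrightarrow> Q q \<Longrightarrow> Q (p + q)"
    and scale: "\<And>c p. Q p \<Longrightarrow> Q (abs_uea (scalar c) * p)"
    and hel: "\<And>i p. Q p \<Longrightarrow> Q (abs_uea (letter (Abs_cartan (hel i))) * p)"
  shows "Q u"
proof -
  have Q_zero: "Q 0"
    using scalar[of 0] by (simp add: scalar_def zero_uea_def)
  have letter: "Q (abs_uea (letter x) * p)" if "Q p" for x :: "'n cartan" and p
  proof -
    have "witt_of_cartan x \<in> lie.span (range hel)"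
      by (rule witt_of_cartan)
    \<comment> \<open>The span induction runs inside the Witt algebra; the witness \<open>z\<close>
      carries each partial combination back to \<open>'n cartan\<close>.\<close>
    then have "\<exists>z. witt_of_cartan z = witt_of_cartan x \<and> Q (abs_uea (letter z) * p)"
    proof (induction rule: lie.span_induct_alt)
      case base
      have "abs_uea (letter (0::'n cartan)) = 0"
        using uea_letter_add[of "0::'n cartan" 0] by simp
      then show ?case
        by (intro exI[of _ 0]) (simp add: zero_cartan.rep_eq Q_zero)
    next
      case (step c x y)
      then obtain i z where x: "x = hel i" and z: "witt_of_cartan z = y" "Q (abs_uea (letter z) * p)"
        by blast
      have "witt_of_cartan (Abs_cartan (hel i) :: 'n cartan) = hel i"
        by (rule Abs_cartan_inverse) (simp add: lie.span_base)
      then show ?case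
        using z scale[OF hel[OF that]]
        by (intro exI[of _ "lie_scale c (Abs_cartan (hel i)) + z"])
           (simp add: x plus_cartan.rep_eq lie_scale_cartan.rep_eq uea_letter_add uea_letter_scale
             distrib_right add mult.assoc)
    qed
    then show ?thesis
      using cartan_eqI by blast
  qed
  have "Q (abs_uea f)" for f :: "'n cartan free_algebra"
  proof (induction f rule: poly_mapping_additive_induct)
    case zero
    show ?case using Q_zero by (simp add: zero_uea_def)
  next
    case (single k c)
    \<comment> \<open>The coefficient \<open>c\<close> is placed at the empty word, and letters are
      prefixed one by one.\<close>
    have "Q (abs_uea (Poly_Mapping.single (Word xs) c))" for xs :: "'n cartan list"
    proof (induction xs)
      case Nil
      show ?case using scalar[of c] by (simp add: scalar_def zero_word_def)
    next
      case (Cons x xs)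
      have "Poly_Mapping.single (Word (x # xs)) c = letter x * Poly_Mapping.single (Word xs) c"
        by (simp add: letter_def mult_single plus_word_def)
      then show ?case
        using letter[OF Cons.IH, of x] by (simp add: times_uea.abs_eq)
    qed
    then show ?case by (cases k) simp
  next
    case (add p q)
    then show ?case using assms(2) by (simp flip: plus_uea.abs_eq)
  qed
  then show ?thesis
    by (metis Quotient3_abs_rep[OF Quotient3_uea])
qed

section \<open>Application to Whittaker modules\<close>

theorem corollary4p2:
  fixes a :: "'n::finite \<Rightarrow> complex"
    and scale :: "complex \<Rightarrow> 'm::ab_group_add \<Rightarrow> 'm"
    and act :: "'n witt \<Rightarrow> 'm \<Rightarrow> 'm"
  assumes "\<And>i. a i \<noteq> 0"
    and "in_Omega scale act a"
    and "\<not> trivial_module act"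
  shows "free_of_finite_rank (uea_act scale (restrict_cartan act))"
proof -
  let ?s = "uea_act scale (restrict_cartan act)"
  let ?sc = "\<lambda>c. abs_uea (scalar c) :: 'n cartan uea"
  let ?H = "\<lambda>i. abs_uea (letter (Abs_cartan (hel i))) :: 'n cartan uea"
  have W: "lie_module scale act" and Wh: "whittaker scale act (phi a)"
    and "finite_dimensional_subspace scale (Wh scale act a)"
    using assms(2) by (simp_all add: in_Omega_def)
  then obtain B where B: "finite B" "\<not> module.dependent scale B"
    "module.span scale B = {v. \<forall>i. act (partial i) v = scale (a i) v}"
    by (auto simp: finite_dimensional_subspace_def Wh_def)
  interpret W: lie_module scale act by (rule W)
  interpret h: lie_module scale "restrict_cartan act"
    by unfold_locales
       (simp_all add: restrict_cartan_def plus_cartan.rep_eq lie_scale_cartan.rep_eq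
         lie_bracket_cartan.rep_eq W.act_add_left W.act_scale_left W.act_add_right
         W.act_scale_right W.act_bracket)
  have "module ?s"
    by (rule uea_module) (rule h.lie_module_axioms)
  then interpret s: module ?s .
  have H: "?s (?H i) v = act (hel i) v" for i v
    by (simp add: h.uea_act_abs restrict_cartan_def Abs_cartan_inverse lie.span_base)
  \<comment> \<open>Together with the computed brackets, this rule yields all commutation laws
    required of \<open>P\<close> and \<open>H\<close>.\<close>
  have swap: "act x (act y v) = act (lie_bracket x y) v + act y (act x v)" for x y v
    by (simp add: W.act_bracket)
  have act_zero: "act 0 v = 0" for v
    using W.act_add_left[of 0 0 v] by simp
  interpret shift_module ?s scale ?sc ?H "\<lambda>i. act (partial i)" a
  proof unfold_locales
    fix c d v w i j
    show "?s (?sc c) v = scale c v"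
      by (simp add: h.uea_act_abs)
    show "?sc (c + d) = ?sc c + ?sc d"
      by (simp add: plus_uea.abs_eq scalar_def single_add)
    show "?sc (c * d) = ?sc c * ?sc d"
      by (simp add: times_uea.abs_eq scalar_def mult_single)
    show "?sc 1 = 1"
      by (simp add: one_uea_def scalar_def)
    show "act (partial i) (v + w) = act (partial i) v + act (partial i) w"
      by (rule W.act_add_right)
    show "act (partial i) (scale c v) = scale c (act (partial i) v)"
      by (rule W.act_scale_right)
    show "act (partial i) (act (partial j) v) = act (partial j) (act (partial i) v)"
      by (subst swap) (simp add: bracket_partial act_zero)
    show "act (partial i) (?s (?H j) v) = ?s (?H j) (act (partial i) v)" if "i \<noteq> j"
      unfolding H by (subst swap) (simp add: bracket_partial_hel act_zero that)
    show "act (partial i) (?s (?H i) v) = ?s (?H i + 1) (act (partial i) v)"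
      unfolding s.scale_left_distrib H
      by (subst swap) (simp add: bracket_partial_hel)
    show "a i \<noteq> 0"
      by (rule assms(1))
    have "partial i \<in> Delta"
      by (simp add: Delta_def lie.span_base)
    \<comment> \<open>The Whittaker condition is used at \<open>partial i\<close>, where the linear
      form takes the value \<open>a i\<close>.\<close>
    with Wh show "\<exists>k. ((\<lambda>w. act (partial i) w - scale (a i) w) ^^ k) v = 0"
      unfolding whittaker_def by (metis phi_partial)
  next
    fix Q :: "'n cartan uea \<Rightarrow> bool" and u
    assume "\<And>c. Q (?sc c)" "\<And>p q. Q p \<Longrightarrow> Q q \<Longrightarrow> Q (p + q)" "\<And>c p. Q p \<Longrightarrow> Q (?sc c * p)"
      "\<And>i p. Q p \<Longrightarrow> Q (?H i * p)"
    then show "Q u"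
      by (rule uea_cartan_induct)
  qed
  \<comment> \<open>The basis \<open>B\<close> of the Whittaker vectors serves as the basis over
    U(h_n), so the rank is the dimension of that space.\<close>
  show ?thesis
    unfolding free_of_finite_rank_def
    using \<open>module ?s\<close> B free_over_kernel[OF B] by blast
qed

end
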